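(* Consider the quadratic measurement model $y_i=\boldsymbol\beta^{\star\top}\boldsymbol Z_i\boldsymbol\beta^\star+\varepsilon_i$, $i=1,\dots,n$, with true parameter $\boldsymbol\beta^\star\in\mathbb R^d$, support $\Gamma^\star$ of size $s$, $\boldsymbol\beta_1^\star:=\boldsymbol\beta^\star_{\Gamma^\star}\in\mathbb R^s$, and let $\lambda_n>0$. Suppose the standing conditions and Assumptions 1, 2 and 3 listed in the context hold. Let $$\hat{\boldsymbol\beta}_1^o\in\arg\min_{\boldsymbol\beta_1\in\mathbb R^s}\ \frac1{4n}\sum_{i=1}^n\big(\boldsymbol\beta_1^\top\boldsymbol Z_i^{\Gamma^\star\Gamma^\star}\boldsymbol\beta_1-y_i\big)^2+\sum_{j\in\Gamma^\star} p_{\lambda_n}\big(|\beta_j|\big)$$ be the oracle regularized least squares estimator, where $\beta_j$, $j\in\Gamma^\star$, denote the entries of $\boldsymbol\beta_1$. If $c_4\ge 3/(ns)$, then $$\mathbb P\Big(\|\hat{\boldsymbol\beta}_1^o-\boldsymbol\beta_1^\star\|\le r_n\Big)\ \ge\ 1-p_1-p_2,$$ where $p_1=2\exp\{-s\ln(1+2n)\}$, $p_2=n^{-n/2}$, $$r_n=C_0\Big(\sqrt{\tfrac{\ln(1+2n)}{n}}+\tfrac{\lambda_n\varrho}{\sqrt s}\Big),\qquad C_0=\max\Big\{\frac{10\sigma\sqrt{c_4}}{c_1c_3},\ \frac{4}{c_1^2c_3}\Big\}.$$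
   Context: Notation. $\|\cdot\|$ is the Euclidean norm. For a matrix $\boldsymbol Z$, $|\boldsymbol Z|_\infty$ is the maximum absolute value of its entries. $\boldsymbol Z^{\Gamma_1\Gamma_2}$ is the submatrix with rows indexed by $\Gamma_1$ and columns indexed by $\Gamma_2$; $\boldsymbol\beta_\Gamma$ is the subvector indexed by $\Gamma$. Model. $\boldsymbol Z_1,\dots,\boldsymbol Z_n\in\mathbb R^{d\times d}$ are symmetric design matrices, $\boldsymbol\beta^\star\in\mathbb R^d$ is the true parameter, $\Gamma^\star=\{j:\beta^\star_j\ne0\}$, $s=|\Gamma^\star|$ is the number of nonzero entries of $\boldsymbol\beta^\star$, $y_i\in\mathbb R$ are the observed responses and $\varepsilon_i\in\mathbb R$ are random errors. Standing conditions. (a) High-dimensional setting: $d$ is larger than $n$, and $\ln d=o(n^\alpha)$ for some constant $\alpha\in(0,1)$. (b) There are constants $0<c_1\le c_2<\infty$ with $c_1\le|\beta_j^\star|\le c_2$ for all $j\in\Gamma^\star$. (c) The responses and design matrices are standardized so that $\sum_{i=1}^n y_i=0$ and $\sum_{i=1}^n|\boldsymbol Z_i|_\infty^2=n$. Assumption 1 (weakly convex-concave penalty). The penalty is $P_{\lambda_n}(\boldsymbol\beta)=\sum_{j=1}^d p_{\lambda_n}(|\beta_j|)$ with a scalar function $p_{\lambda_n}$ such that: (i) $p_{\lambda_n}$ is concave on $(0,\infty)$ and there is $\mu>0$ such that $p_{\lambda_n}(t)+\frac\mu2t^2$ is convex; (ii) $p_{\lambda_n}(0)=0$ and $p_{\lambda_n}(t)>0$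 for $t>0$; (iii) for $t>0$, $p_{\lambda_n}$ is non-decreasing and $t\mapsto p_{\lambda_n}(t)/t$ is non-increasing; (iv) $p_{\lambda_n}$ is differentiable with derivative $p'_{\lambda_n}$ for all $t>0$ and subdifferentiable at $t=0$, with $\lim_{t\to0^+}p'_{\lambda_n}(t)=\lambda_n\varrho$, $\varrho>0$, and $p'_{\lambda_n}$ is locally Lipschitz continuous on $(0,\infty)$. Assumption 2. $\varepsilon_1,\dots,\varepsilon_n$ are independent and identically distributed sub-Gaussian with variance proxy $\sigma^2$ (i.e. $\mathbb E e^{t\varepsilon_i}\le e^{\sigma^2t^2/2}$ for all $t\in\mathbb R$), and each $\varepsilon_i$ has zero mean and positive variance. Assumption 3. There are constants $c_4\ge c_3>0$ such that for all $\boldsymbol x,\boldsymbol y\in\mathbb R^s$, $c_3\|\boldsymbol x\|^2\|\boldsymbol y\|^2\le\frac1n\sum_{i=1}^n(\boldsymbol x^\top\boldsymbol Z_i^{\Gamma^\star\Gamma^\star}\boldsymbol y)^2\le c_4\|\boldsymbol x\|^2\|\boldsymbol y\|^2$.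
   Formalization: The estimation error is measured up to a global sign (the objective is even, so the negative of a minimizer is also a minimizer and the literal bound fails), and Σ y_i = 0 is required only in expectation, since almost surely it contradicts independent errors of positive variance. *)

theory Defs
  imports "HOL-Probability.Probability" "HOL-Library.Landau_Symbols"
begin

definition supp :: "real ^ 'd \<Rightarrow> 'd set" where
  "supp b = {j. b $ j \<noteq> 0}"

definition max_abs_entry :: "real ^ 'd ^ 'd \<Rightarrow> real" where
  "max_abs_entry A = Max (range (\<lambda>(j, k). \<bar>A $ j $ k\<bar>))"

text \<open>Subvectors and submatrices indexed by a set \<open>G\<close> of \<open>s\<close> coordinates: the index
  type \<open>'s\<close> stands for \<open>{1..s}\<close>, and \<open>e\<close> is an enumeration of \<open>G\<close>,
  that is \<open>bij_betw e UNIV G\<close>.\<close>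

definition subvec :: "('s \<Rightarrow> 'd) \<Rightarrow> real ^ 'd \<Rightarrow> real ^ 's" where
  "subvec e b = (\<chi> a. b $ e a)"

definition submat :: "('s \<Rightarrow> 'd) \<Rightarrow> real ^ 'd ^ 'd \<Rightarrow> real ^ 's ^ 's" where
  "submat e A = (\<chi> a b. A $ e a $ e b)"

text \<open>Regular (Frechet) subdifferentiability. For weakly convex functions all the usual
  subdifferentials coincide.\<close>

definition subdifferentiable_at :: "(real \<Rightarrow> real) \<Rightarrow> real \<Rightarrow> bool" where
  "subdifferentiable_at f x \<longleftrightarrow>
     (\<exists>g. \<forall>e>0. \<forall>\<^sub>F h in at 0. f (x + h) - f x - g * h \<ge> - e * \<bar>h\<bar>)"

text \<open>Only the values of \<open>p\<close> on \<open>[0, \<infinity>)\<close> are meaningful. Convexity is required on the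
  closed half-line; on the open one a jump of \<open>p\<close> at \<open>0\<close> would be admitted.
  Subdifferentiability at \<open>0\<close> concerns the even function \<open>t \<mapsto> p \<bar>t\<bar>\<close> that enters the
  penalty.\<close>

definition weakly_convex_concave_penalty :: "real \<Rightarrow> real \<Rightarrow> (real \<Rightarrow> real) \<Rightarrow> bool" where
  "weakly_convex_concave_penalty lam rho p \<longleftrightarrow>
     concave_on {0<..} p \<and>
     (\<exists>\<mu>>0. convex_on {0..} (\<lambda>t. p t + \<mu> / 2 * t\<^sup>2)) \<and>
     p 0 = 0 \<and> (\<forall>t>0. p t > 0) \<and>
     mono_on {0<..} p \<and> antimono_on {0<..} (\<lambda>t. p t / t) \<and>
     (\<forall>t>0. p differentiable (at t)) \<and>
     subdifferentiable_at (\<lambda>t. p \<bar>t\<bar>) 0 \<and>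
     rho > 0 \<and> (deriv p \<longlongrightarrow> lam * rho) (at_right 0) \<and>
     (\<forall>t>0. \<exists>u>0. \<exists>L. L-lipschitz_on (ball t u \<inter> {0<..}) (deriv p))"

definition (in prob_space) subgaussian :: "real \<Rightarrow> ('a \<Rightarrow> real) \<Rightarrow> bool" where
  "subgaussian v X \<longleftrightarrow> random_variable borel X \<and>
     (\<forall>t. integrable M (\<lambda>\<omega>. exp (t * X \<omega>)) \<and>
          expectation (\<lambda>\<omega>. exp (t * X \<omega>)) \<le> exp (v * t\<^sup>2 / 2))"

definition (in prob_space) iid_subgaussian_errors ::
    "real \<Rightarrow> nat \<Rightarrow> (nat \<Rightarrow> 'a \<Rightarrow> real) \<Rightarrow> bool" where
  "iid_subgaussian_errors \<sigma> n \<epsilon> \<longleftrightarrow>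
     indep_vars (\<lambda>_. borel) \<epsilon> {1..n} \<and>
     (\<forall>i\<in>{1..n}. \<forall>k\<in>{1..n}. distr M borel (\<epsilon> i) = distr M borel (\<epsilon> k)) \<and>
     (\<forall>i\<in>{1..n}. subgaussian (\<sigma>\<^sup>2) (\<epsilon> i) \<and>
        expectation (\<epsilon> i) = 0 \<and> variance (\<epsilon> i) > 0)"

text \<open>Centering of the responses is stated in mean. For independent errors with positive variance
  the sum of the responses has positive variance, so it cannot vanish almost surely; if it did,
  the condition below would follow.\<close>

definition (in prob_space) standardized ::
    "nat \<Rightarrow> (nat \<Rightarrow> real ^ 'd ^ 'd) \<Rightarrow> (nat \<Rightarrow> 'a \<Rightarrow> real) \<Rightarrow> bool" where
  "standardized n Z y \<longleftrightarrow>
     (\<Sum>i=1..n. expectation (y i)) = 0 \<and> (\<Sum>i=1..n. (max_abs_entry (Z i))\<^sup>2) = real n"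

definition oracle_objective ::
    "nat \<Rightarrow> (nat \<Rightarrow> real ^ 's ^ 's) \<Rightarrow> (nat \<Rightarrow> real) \<Rightarrow> (real \<Rightarrow> real) \<Rightarrow> real ^ 's \<Rightarrow> real" where
  "oracle_objective n Z y p b =
     1 / (4 * real n) * (\<Sum>i=1..n. (b \<bullet> (Z i *v b) - y i)\<^sup>2) + (\<Sum>j\<in>UNIV. p \<bar>b $ j\<bar>)"

text \<open>The responses determine the parameter only up to a global sign, and the objective is
  even, so that the negative of a minimizer is again a minimizer. The estimation error is
  therefore measured up to this sign; it is \<open>norm (x - y)\<close> for the representative \<open>x\<close> of
  the pair \<open>x\<close>, \<open>- x\<close> that is closer to \<open>y\<close>.\<close>

definition norm_up_to_sign :: "'v::real_normed_vector \<Rightarrow> 'v \<Rightarrow> real" where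
  "norm_up_to_sign x y = min (norm (x - y)) (norm (- x - y))"

end

theory Submission
  imports Defs
begin

text \<open>
  Write \<open>c\<close> for the true parameter restricted to its support, \<open>b\<close> for a minimizer,
  \<open>A\<^sub>i\<close> for the restricted design matrices, and \<open>u = b - c\<close>, \<open>v = b + c\<close>. Symmetry of \<open>A\<^sub>i\<close> makes
  the difference of the two quadratic forms bilinear,
  \<open>b \<bullet> A\<^sub>i b - c \<bullet> A\<^sub>i c = u \<bullet> A\<^sub>i v\<close>. Since the objective at \<open>b\<close> is at most the objective at \<open>c\<close>,
  the sum of \<open>(u \<bullet> A\<^sub>i v)\<^sup>2\<close>, which is at least \<open>n c3 \<parallel>u\<parallel>\<^sup>2 \<parallel>v\<parallel>\<^sup>2\<close>, is at most twice the noise term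
  \<open>\<Sum> \<epsilon>\<^sub>i (u \<bullet> A\<^sub>i v)\<close> plus \<open>4 n\<close> times the difference of the penalties of \<open>c\<close> and \<open>b\<close>.

  The penalty grows at rate at most \<open>lam * rho\<close>, its slope at \<open>0\<close> (\<open>penalty_diff_le\<close>), so by
  Cauchy-Schwarz the difference of the penalties is at most \<open>lam rho \<surd>s \<parallel>u\<parallel>\<close>. If the noise term is at most
  \<open>H \<parallel>u\<parallel> \<parallel>v\<parallel>\<close>, one may divide by \<open>\<parallel>u\<parallel> \<parallel>v\<parallel>\<^sup>2\<close>. The objective is even, so \<open>b\<close> may be replaced by \<open>- b\<close>
  to make \<open>v\<close> the longer of the two vectors; then \<open>\<parallel>v\<parallel> \<ge> \<parallel>c\<parallel> \<ge> c1 \<surd>s\<close>, and a bound on \<open>\<parallel>u\<parallel>\<close> follows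
  (\<open>error_bound_up_to_sign\<close>).

  The probabilistic part is the bound on the noise, uniform in \<open>u\<close> and \<open>v\<close>, with
  \<open>H = 5 \<sigma> \<surd>(c4 s n L)\<close> and \<open>L = ln (1 + 2 n)\<close> (\<open>subgaussian_bilinear_form_bound\<close>). For fixed unit vectors
  the noise is sub-Gaussian with variance proxy at most \<open>\<sigma>\<^sup>2 n c4\<close>. A bilinear form that is at most \<open>t\<close> on a
  \<open>\<delta>\<close>-net of the unit ball is at most \<open>t / (1 - \<delta>)\<^sup>2\<close> on the whole ball, so a net of constant
  resolution \<open>\<delta> = 1 / 10\<close> suffices. It has at most \<open>21\<^sup>s\<close> points, and \<open>21 \<le> (1 + 2 n)\<^sup>3\<close>: the union
  bound over pairs costs a factor \<open>exp (6 s L)\<close> against a tail of \<open>exp (- 8 s L)\<close>. The remaining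
  failure probability \<open>exp (- 2 s L)\<close> is below \<open>p1\<close>.
\<close>

section \<open>Nets of the unit ball\<close>

text \<open>The volume argument: the balls of radius \<open>\<delta> / 2\<close> around separated points of the unit
  ball are disjoint and lie in a ball of radius \<open>1 + \<delta> / 2\<close>.\<close>

lemma card_separated_le:
  fixes S :: "'a::euclidean_space set"
  assumes "finite S" and sub: "S \<subseteq> cball 0 1" and "\<delta> > 0"
    and sep: "\<And>x y. x \<in> S \<Longrightarrow> y \<in> S \<Longrightarrow> x \<noteq> y \<Longrightarrow> dist x y \<ge> \<delta>"
  shows "real (card S) \<le> (1 + 2 / \<delta>) ^ DIM('a)"
proof -
  let ?V = "unit_ball_vol (real DIM('a))"
  have disj: "disjoint_family_on (\<lambda>x. ball x (\<delta> / 2)) S"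
    unfolding disjoint_family_on_def
  proof (intro ballI impI)
    fix x y assume xy: "x \<in> S" "y \<in> S" "x \<noteq> y"
    show "ball x (\<delta> / 2) \<inter> ball y (\<delta> / 2) = {}"
      using sep[OF xy] by (simp add: disjoint_ballI)
  qed
  have incl: "(\<Union>x\<in>S. ball x (\<delta> / 2)) \<subseteq> ball 0 (1 + \<delta> / 2)"
  proof safe
    fix x y assume "x \<in> S" "y \<in> ball x (\<delta> / 2)"
    then show "y \<in> ball 0 (1 + \<delta> / 2)"
      using sub dist_triangle[of 0 y x] by auto
  qed
  have fin: "emeasure lborel (ball x r) \<noteq> \<infinity>" for x :: 'a and r
    using emeasure_bounded_finite[OF bounded_ball[of x r]] by (simp add: less_top)
  have "real (card S) * (?V * (\<delta> / 2) ^ DIM('a)) = (\<Sum>x\<in>S. measure lborel (ball x (\<delta> / 2)))"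
    using \<open>\<delta> > 0\<close> by (simp add: content_ball)
  also have "\<dots> = measure lborel (\<Union>x\<in>S. ball x (\<delta> / 2))"
    using assms(1) disj fin by (intro measure_finite_Union[symmetric]) auto
  also have "\<dots> \<le> measure lborel (ball (0::'a) (1 + \<delta> / 2))"
    using incl fin assms(1) by (intro measure_mono_fmeasurable) (auto simp: fmeasurable_def less_top[symmetric])
  also have "\<dots> = ?V * (1 + \<delta> / 2) ^ DIM('a)"
    using \<open>\<delta> > 0\<close> by (simp add: content_ball)
  also have "1 + \<delta> / 2 = (1 + 2 / \<delta>) * (\<delta> / 2)"
    using \<open>\<delta> > 0\<close> by (simp add: field_simps)
  also have "?V * \<dots> ^ DIM('a) = (1 + 2 / \<delta>) ^ DIM('a) * (?V * (\<delta> / 2) ^ DIM('a))"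
    by (subst power_mult_distrib) simp
  finally show ?thesis
    using \<open>\<delta> > 0\<close> by (simp add: mult_le_cancel_right)
qed

text \<open>A separated set of maximal cardinality is a net, because a point far from all its elements
  could be added to it.\<close>

lemma finite_net_unit_ball:
  fixes \<delta> :: real
  assumes "\<delta> > 0"
  obtains N :: "'a::euclidean_space set"
  where "finite N" "N \<subseteq> cball 0 1" "real (card N) \<le> (1 + 2 / \<delta>) ^ DIM('a)"
    "\<And>x. norm x \<le> 1 \<Longrightarrow> \<exists>q\<in>N. norm (x - q) \<le> \<delta>"
proof -
  define sep where "sep S \<longleftrightarrow> finite S \<and> S \<subseteq> cball 0 1 \<and>
    (\<forall>x\<in>S. \<forall>y\<in>S. x \<noteq> y \<longrightarrow> dist x y \<ge> \<delta>)" for S :: "'a set"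
  have bound: "real (card S) \<le> (1 + 2 / \<delta>) ^ DIM('a)" if "sep S" for S
    using that assms by (intro card_separated_le) (auto simp: sep_def)
  define b where "b = nat \<lfloor>(1 + 2 / \<delta>) ^ DIM('a)\<rfloor>"
  have "card S < Suc b" if "sep S" for S
    using bound[OF that] unfolding b_def by linarith
  then have "\<forall>S. sep S \<longrightarrow> card S < Suc b"
    by blast
  moreover have "sep {}"
    by (simp add: sep_def)
  ultimately obtain N where N: "sep N" and max: "\<And>S. sep S \<Longrightarrow> card S \<le> card N"
    using ex_has_greatest_nat[of sep "{}" card "Suc b"] by metis
  show thesis
  proof (rule that[OF _ _ bound[OF N]])
    show "finite N" "N \<subseteq> cball 0 1"
      using N by (auto simp: sep_def)
    fix x :: 'a assume x: "norm x \<le> 1"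
    show "\<exists>q\<in>N. norm (x - q) \<le> \<delta>"
    proof (rule ccontr)
      assume "\<not> ?thesis"
      then have far: "dist x q > \<delta>" if "q \<in> N" for q
        using that by (auto simp: dist_norm not_le)
      then have "x \<notin> N"
        using assms by force
      moreover have "sep (insert x N)"
        using N far x by (auto simp: sep_def dist_commute less_imp_le)
      ultimately show False
        using max[of "insert x N"] N by (simp add: sep_def)
    qed
  qed
qed

text \<open>If \<open>K\<close> is the maximum of a linear functional over the unit ball, then moving the maximizer
  to the net costs at most \<open>\<delta> K\<close>, so that \<open>K \<le> m + \<delta> K\<close>.\<close>

lemma linear_le_from_net:
  fixes f :: "'a::euclidean_space \<Rightarrow> real"
  assumes lin: "linear f" and \<delta>: "0 < \<delta>" "\<delta> < 1"
    and net: "\<And>x. norm x \<le> 1 \<Longrightarrow> \<exists>q\<in>N. norm (x - q) \<le> \<delta>"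
    and m: "\<And>q. q \<in> N \<Longrightarrow> f q \<le> m"
    and x: "norm x \<le> 1"
  shows "f x \<le> m / (1 - \<delta>)"
proof -
  have "continuous_on (cball 0 1) f"
    using lin by (simp add: linear_continuous_on linear_linear)
  then obtain z where z: "norm z \<le> 1" and K: "\<And>w. norm w \<le> 1 \<Longrightarrow> f w \<le> f z"
    using continuous_attains_sup[of "cball 0 1" f] by auto
  obtain q where q: "q \<in> N" "norm (z - q) \<le> \<delta>"
    using net z by blast
  have "f ((1 / \<delta>) *\<^sub>R (z - q)) \<le> f z"
    using q \<delta> by (intro K) (simp add: divide_le_eq)
  then have "f z - f q \<le> \<delta> * f z"
    using \<delta> lin by (simp add: linear_cmul linear_diff field_simps)
  then have "(1 - \<delta>) * f z \<le> m"
    using m[OF q(1)] by (simp add: algebra_simps)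
  then show ?thesis
    using order_trans[OF K[OF x], of "m / (1 - \<delta>)"] \<delta> by (simp add: pos_le_divide_eq mult.commute)
qed

text \<open>The linear case, applied to one argument at a time; each application costs a
  factor \<open>1 / (1 - \<delta>)\<close>.\<close>

lemma bilinear_le_from_net:
  fixes B :: "'a::euclidean_space \<Rightarrow> 'a \<Rightarrow> real"
  assumes bil: "bilinear B" and \<delta>: "0 < \<delta>" "\<delta> < 1"
    and net: "\<And>x. norm x \<le> 1 \<Longrightarrow> \<exists>q\<in>N. norm (x - q) \<le> \<delta>"
    and m: "\<And>x y. x \<in> N \<Longrightarrow> y \<in> N \<Longrightarrow> B x y \<le> m"
  shows "B x y \<le> m / (1 - \<delta>)\<^sup>2 * norm x * norm y"
proof -
  have lin: "linear (B x)" "linear (\<lambda>x. B x y)" for x y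
    using bil by (auto simp: bilinear_def)
  have half: "B x y \<le> m / (1 - \<delta>)" if "norm x \<le> 1" "y \<in> N" for x y
    by (rule linear_le_from_net[OF lin(2) \<delta> net _ that(1)]) (use m that in auto)
  have ball: "B x y \<le> m / (1 - \<delta>) / (1 - \<delta>)" if "norm x \<le> 1" "norm y \<le> 1" for x y
    by (rule linear_le_from_net[OF lin(1) \<delta> net _ that(2)]) (use half that in auto)
  show ?thesis
  proof (cases "x = 0 \<or> y = 0")
    case True
    then show ?thesis
      using bil by (auto simp: bilinear_lzero bilinear_rzero)
  next
    case False
    have "B ((1 / norm x) *\<^sub>R x) ((1 / norm y) *\<^sub>R y) \<le> m / (1 - \<delta>) / (1 - \<delta>)"
      using False by (intro ball) auto
    then show ?thesis
      using False bil by (simp add: bilinear_lmul bilinear_rmul power2_eq_square field_simps)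
  qed
qed

section \<open>Bilinear forms in independent sub-Gaussian errors\<close>

text \<open>Chernoff's bound: the moment generating function of the sum factorizes, and the exponent
  \<open>\<sigma>\<^sup>2 l\<^sup>2 K / 2 - l t\<close> is smallest at \<open>l = t / (\<sigma>\<^sup>2 K)\<close>.\<close>

lemma (in prob_space) subgaussian_weighted_sum_tail:
  assumes "finite I" and indep: "indep_vars (\<lambda>_. borel) \<epsilon> I"
    and sub: "\<And>i. i \<in> I \<Longrightarrow> subgaussian (\<sigma>\<^sup>2) (\<epsilon> i)"
    and "\<sigma> > 0" "K > 0" "t > 0" and K: "(\<Sum>i\<in>I. (a i)\<^sup>2) \<le> K"
  shows "prob {\<omega> \<in> space M. (\<Sum>i\<in>I. a i * \<epsilon> i \<omega>) \<ge> t} \<le> exp (- (t\<^sup>2 / (2 * \<sigma>\<^sup>2 * K)))"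
proof -
  define l where "l = t / (\<sigma>\<^sup>2 * K)"
  have l: "l > 0"
    using assms by (simp add: l_def)
  let ?S = "\<lambda>\<omega>. \<Sum>i\<in>I. a i * \<epsilon> i \<omega>"
  have ind: "indep_vars (\<lambda>_. borel) (\<lambda>i \<omega>. exp (l * a i * \<epsilon> i \<omega>)) I"
    by (rule indep_vars_compose2[OF indep]) measurable
  have int: "integrable M (\<lambda>\<omega>. exp (l * a i * \<epsilon> i \<omega>))"
    and le: "expectation (\<lambda>\<omega>. exp (l * a i * \<epsilon> i \<omega>)) \<le> exp (\<sigma>\<^sup>2 * (l * a i)\<^sup>2 / 2)" if "i \<in> I" for i
    using sub[OF that] by (auto simp: subgaussian_def)
  have eq: "exp (l * ?S \<omega>) = (\<Prod>i\<in>I. exp (l * a i * \<epsilon> i \<omega>))" for \<omega>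
    using \<open>finite I\<close> by (simp add: sum_distrib_left exp_sum mult.assoc)
  have integrable: "integrable M (\<lambda>\<omega>. exp (l * ?S \<omega>))"
    unfolding eq by (rule indep_vars_integrable[OF \<open>finite I\<close> ind int])
  have "expectation (\<lambda>\<omega>. exp (l * ?S \<omega>)) = (\<Prod>i\<in>I. expectation (\<lambda>\<omega>. exp (l * a i * \<epsilon> i \<omega>)))"
    unfolding eq by (rule indep_vars_lebesgue_integral[OF \<open>finite I\<close> ind int])
  also have "\<dots> \<le> (\<Prod>i\<in>I. exp (\<sigma>\<^sup>2 * (l * a i)\<^sup>2 / 2))"
    using le by (intro prod_mono) auto
  also have "\<dots> = exp (\<sigma>\<^sup>2 * l\<^sup>2 / 2 * (\<Sum>i\<in>I. (a i)\<^sup>2))"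
    using \<open>finite I\<close> by (simp add: exp_sum[symmetric] sum_distrib_left power_mult_distrib mult_ac)
  also have "\<dots> \<le> exp (\<sigma>\<^sup>2 * l\<^sup>2 / 2 * K)"
    using K by (simp add: mult_left_mono)
  finally have mgf: "expectation (\<lambda>\<omega>. exp (l * ?S \<omega>)) \<le> exp (\<sigma>\<^sup>2 * l\<^sup>2 / 2 * K)" .
  have "prob {\<omega> \<in> space M. ?S \<omega> \<ge> t}
      \<le> exp (- l * t) * (\<integral>\<omega>\<in>space M. exp (l * ?S \<omega>) \<partial>M)"
    using integrable
    by (intro Chernoff_ineq_ge l) (auto simp del: real_scaleR_def
        simp: set_integrable_def integrable_mult_indicator)
  also have "\<dots> \<le> exp (- l * t) * exp (\<sigma>\<^sup>2 * l\<^sup>2 / 2 * K)"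
    using mgf integrable by (simp add: set_integral_space)
  also have "\<dots> = exp (- (t\<^sup>2 / (2 * \<sigma>\<^sup>2 * K)))"
    using assms unfolding exp_add[symmetric]
    by (simp add: l_def power2_eq_square field_simps)
  finally show ?thesis .
qed

text \<open>A union bound over pairs of points of a net with \<open>\<delta> = 1 / 10\<close>, which has at most \<open>21\<^sup>s\<close>
  points; \<open>(1 - \<delta>)\<^sup>2 \<ge> 4 / 5\<close> turns the bound \<open>t\<close> on the net into \<open>5 / 4 * t\<close> everywhere.\<close>

lemma (in prob_space) subgaussian_bilinear_form_bound:
  fixes A :: "'i \<Rightarrow> real ^ 's ^ 's"
  assumes "finite I" and indep: "indep_vars (\<lambda>_. borel) \<epsilon> I"
    and sub: "\<And>i. i \<in> I \<Longrightarrow> subgaussian (\<sigma>\<^sup>2) (\<epsilon> i)"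
    and "\<sigma> > 0" "K > 0" "t > 0"
    and K: "\<And>x y. (\<Sum>i\<in>I. (x \<bullet> (A i *v y))\<^sup>2) \<le> K * (norm x)\<^sup>2 * (norm y)\<^sup>2"
  obtains G where "G \<in> events"
    "prob G \<ge> 1 - 21 ^ (2 * CARD('s)) * exp (- (t\<^sup>2 / (2 * \<sigma>\<^sup>2 * K)))"
    "\<And>\<omega> x y. \<omega> \<in> G \<Longrightarrow> (\<Sum>i\<in>I. \<epsilon> i \<omega> * (x \<bullet> (A i *v y))) \<le> 5 / 4 * t * norm x * norm y"
proof -
  define \<delta> :: real where "\<delta> = 1 / 10"
  then have "\<delta> > 0"
    by simp
  then obtain N :: "(real ^ 's) set" where N: "finite N" "N \<subseteq> cball 0 1"
    "real (card N) \<le> (1 + 2 / \<delta>) ^ DIM(real ^ 's)"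
    and net: "\<And>x. norm x \<le> 1 \<Longrightarrow> \<exists>q\<in>N. norm (x - q) \<le> \<delta>"
    by (rule finite_net_unit_ball) (rule that)
  have [measurable]: "\<epsilon> i \<in> borel_measurable M" if "i \<in> I" for i
    using sub[OF that] by (simp add: subgaussian_def)
  define E where "E = (\<lambda>(x, y). {\<omega> \<in> space M. (\<Sum>i\<in>I. (x \<bullet> (A i *v y)) * \<epsilon> i \<omega>) \<ge> t})"
  let ?q = "exp (- (t\<^sup>2 / (2 * \<sigma>\<^sup>2 * K)))"
  have E: "E z \<in> events" for z
    unfolding E_def by (cases z) simp
  have tail: "prob (E z) \<le> ?q" if zN: "z \<in> N \<times> N" for z
  proof -
    obtain x y where z: "z = (x, y)" "x \<in> N" "y \<in> N"
      using zN by auto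
    have "(norm x)\<^sup>2 * (norm y)\<^sup>2 \<le> 1"
      using z N(2) by (intro mult_le_one) (auto simp: power_le_one)
    then have "K * ((norm x)\<^sup>2 * (norm y)\<^sup>2) \<le> K"
      using \<open>K > 0\<close> by (simp add: mult_left_le)
    then have "(\<Sum>i\<in>I. (x \<bullet> (A i *v y))\<^sup>2) \<le> K"
      using K[of x y] by (simp add: mult.assoc)
    then show ?thesis
      unfolding z E_def prod.case by (intro subgaussian_weighted_sum_tail assms)
  qed
  have card: "real (card (N \<times> N)) \<le> 21 ^ (2 * CARD('s))"
  proof -
    have "real (card N) \<le> 21 ^ CARD('s)"
      using N(3) by (simp add: \<delta>_def)
    then have "real (card N) * real (card N) \<le> 21 ^ CARD('s) * 21 ^ CARD('s)"
      by (intro mult_mono) auto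
    then show ?thesis
      by (simp add: card_cartesian_product mult_2 power_add)
  qed
  define G where "G = space M - (\<Union>z\<in>N \<times> N. E z)"
  show thesis
  proof (rule that[of G])
    have un: "(\<Union>z\<in>N \<times> N. E z) \<in> events"
      using E N(1) by (intro sets.finite_UN) auto
    then show "G \<in> events"
      by (auto simp: G_def)
    have "prob (\<Union>z\<in>N \<times> N. E z) \<le> (\<Sum>z\<in>N \<times> N. prob (E z))"
      using E N(1) by (intro finite_measure_subadditive_finite) auto
    also have "\<dots> \<le> (\<Sum>z\<in>N \<times> N. ?q)"
      by (intro sum_mono tail)
    also have "\<dots> \<le> 21 ^ (2 * CARD('s)) * ?q"
      using card by (simp add: mult_right_mono)
    finally show "prob G \<ge> 1 - 21 ^ (2 * CARD('s)) * ?q"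
      using prob_compl[OF un] by (simp add: G_def)
    fix \<omega> x y assume \<omega>: "\<omega> \<in> G"
    define B where "B = (\<lambda>x y. \<Sum>i\<in>I. \<epsilon> i \<omega> * (x \<bullet> (A i *v y)))"
    have "bilinear B"
      unfolding bilinear_def linear_iff B_def
      by (simp add: inner_add_left inner_add_right matrix_vector_right_distrib
          matrix_vector_mult_scaleR sum.distrib sum_distrib_left algebra_simps)
    moreover have "B x y \<le> t" if "x \<in> N" "y \<in> N" for x y
      using \<omega> that unfolding G_def E_def B_def by (force simp: mult.commute not_le)
    ultimately have "B x y \<le> t / (1 - \<delta>)\<^sup>2 * norm x * norm y"
      by (intro bilinear_le_from_net[OF _ _ _ net]) (auto simp: \<delta>_def)
    also have "\<dots> \<le> 5 / 4 * t * norm x * norm y"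
      using \<open>t > 0\<close> by (intro mult_right_mono) (auto simp: \<delta>_def power2_eq_square)
    finally show "(\<Sum>i\<in>I. \<epsilon> i \<omega> * (x \<bullet> (A i *v y))) \<le> 5 / 4 * t * norm x * norm y"
      by (simp add: B_def)
  qed
qed

section \<open>Growth of the penalty\<close>

text \<open>The tangents of a concave function have decreasing slopes, and the slope at \<open>0\<close> is the limit
  \<open>lam * rho\<close>. Weak convexity is what excludes a jump at \<open>0\<close>.\<close>

lemma penalty_diff_le:
  assumes A1: "weakly_convex_concave_penalty lam rho p" and "0 \<le> s" "s \<le> t"
  shows "p t - p s \<le> lam * rho * (t - s)"
proof -
  have conc: "convex_on {0<..} (\<lambda>t. - p t)" and lim: "(deriv p \<longlongrightarrow> lam * rho) (at_right 0)"
    and p0: "p 0 = 0" and diff: "\<And>t. t > 0 \<Longrightarrow> p differentiable (at t)"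
    using A1 by (auto simp: weakly_convex_concave_penalty_def concave_on_def)
  obtain \<mu> where \<mu>: "convex_on {0..} (\<lambda>t. p t + \<mu> / 2 * t\<^sup>2)"
    using A1 by (auto simp: weakly_convex_concave_penalty_def)
  have tangent: "p y \<le> p x + deriv p x * (y - x)" if "x > 0" "y > 0" for x y
  proof -
    have "p differentiable (at x)"
      using that by (intro diff)
    then have "(p has_field_derivative deriv p x) (at x within {0<..})"
      by (auto simp: real_differentiable_def DERIV_imp_deriv has_field_derivative_at_within)
    then have "((\<lambda>t. - p t) has_field_derivative - deriv p x) (at x within {0<..})"
      by (rule DERIV_minus)
    then show ?thesis
      using convex_on_imp_above_tangent[OF conc, of x y "- deriv p x"] that
      by (simp add: interior_open algebra_simps)
  qed
  have slope: "deriv p x \<le> lam * rho" if "x > 0" for x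
  proof (rule tendsto_lowerbound[OF lim])
    have "deriv p x \<le> deriv p h" if "0 < h" "h < x" for h
    proof -
      have "deriv p x * (x - h) \<le> deriv p h * (x - h)"
        using tangent[of x h] tangent[of h x] that by (simp add: algebra_simps)
      then show ?thesis
        using that by simp
    qed
    then show "\<forall>\<^sub>F h in at_right 0. deriv p x \<le> deriv p h"
      using \<open>x > 0\<close> by (auto simp: eventually_at_right)
  qed simp
  have pos: "p t - p s \<le> lam * rho * (t - s)" if "0 < s" "s \<le> t" for s t
    using tangent[of s t] mult_right_mono[OF slope[of s], of "t - s"] that by simp
  show ?thesis
  proof (cases "s = 0 \<and> t > 0")
    case False
    then show ?thesis
      using pos assms by (cases "s = 0") auto
  next
    case True
    \<comment> \<open>\<open>k\<close> is the slope of the chord over \<open>[0, t]\<close> of the convex function \<open>p + \<mu> / 2 * t\<^sup>2\<close>; it bounds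
      \<open>p h\<close> near \<open>0\<close>, and letting \<open>h\<close> tend to \<open>0\<close> extends the case \<open>s > 0\<close> to \<open>s = 0\<close>.\<close>
    define k where "k = (p t + \<mu> / 2 * t\<^sup>2) / t"
    have "p t \<le> lam * rho * (t - h) + (h * k - \<mu> / 2 * h\<^sup>2)" if h: "0 < h" "h < t" for h
    proof -
      have "p h + \<mu> / 2 * h\<^sup>2 \<le> h * k"
        using convex_onD[OF \<mu>, of "h / t" 0 t] True h p0 by (simp add: k_def)
      then show ?thesis
        using pos[of h t] h by simp
    qed
    then have ev: "\<forall>\<^sub>F h in at_right 0. p t \<le> lam * rho * (t - h) + (h * k - \<mu> / 2 * h\<^sup>2)"
      unfolding eventually_at_right[OF conjunct2[OF True]] using True by blast
    have "((\<lambda>h. lam * rho * (t - h) + (h * k - \<mu> / 2 * h\<^sup>2))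
        \<longlongrightarrow> lam * rho * (t - 0) + (0 * k - \<mu> / 2 * 0\<^sup>2)) (at_right 0)"
      by (intro tendsto_intros)
    then have "p t \<le> lam * rho * (t - 0) + (0 * k - \<mu> / 2 * 0\<^sup>2)"
      using ev by (rule tendsto_lowerbound) simp
    then show ?thesis
      using True p0 by simp
  qed
qed

lemma penalty_mono:
  assumes A1: "weakly_convex_concave_penalty lam rho p" and "0 \<le> s" "s \<le> t"
  shows "p s \<le> p t"
proof (cases "s = 0")
  case True
  then show ?thesis
    using assms by (cases "t = 0") (auto simp: weakly_convex_concave_penalty_def less_imp_le)
next
  case False
  then show ?thesis
    using assms by (auto simp: weakly_convex_concave_penalty_def mono_on_def)
qed

text \<open>Coordinates that grow in absolute value from \<open>c\<close> to \<open>b\<close> only lower the left-hand side; the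
  others are controlled by the growth rate, and Cauchy-Schwarz turns their sum into a norm.\<close>

lemma sum_penalty_diff_le:
  fixes b c :: "real ^ 's"
  assumes A1: "weakly_convex_concave_penalty lam rho p" and "lam > 0"
  shows "(\<Sum>j\<in>UNIV. p \<bar>c $ j\<bar>) - (\<Sum>j\<in>UNIV. p \<bar>b $ j\<bar>)
    \<le> lam * rho * (sqrt (real CARD('s)) * norm (b - c))"
proof -
  have lr: "lam * rho > 0"
    using assms by (simp add: weakly_convex_concave_penalty_def)
  have each: "p \<bar>c $ j\<bar> - p \<bar>b $ j\<bar> \<le> lam * rho * \<bar>(b - c) $ j\<bar>" for j
  proof (cases "\<bar>b $ j\<bar> \<le> \<bar>c $ j\<bar>")
    case True
    have "p \<bar>c $ j\<bar> - p \<bar>b $ j\<bar> \<le> lam * rho * (\<bar>c $ j\<bar> - \<bar>b $ j\<bar>)"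
      using True by (intro penalty_diff_le[OF A1]) auto
    also have "\<dots> \<le> lam * rho * \<bar>(b - c) $ j\<bar>"
      using lr by (intro mult_left_mono) auto
    finally show ?thesis .
  next
    case False
    then have "p \<bar>c $ j\<bar> \<le> p \<bar>b $ j\<bar>"
      by (intro penalty_mono[OF A1]) auto
    moreover have "0 \<le> lam * rho * \<bar>(b - c) $ j\<bar>"
      using lr by simp
    ultimately show ?thesis
      by linarith
  qed
  have "(\<Sum>j\<in>UNIV. \<bar>(b - c) $ j\<bar>)\<^sup>2 \<le> (norm (b - c))\<^sup>2 * real CARD('s)"
    using sum_squared_le_sum_of_squares[of "\<lambda>j. \<bar>(b - c) $ j\<bar>" UNIV]
    by (simp add: norm_vec_def L2_set_def sum_nonneg)
  then have "(\<Sum>j\<in>UNIV. \<bar>(b - c) $ j\<bar>) \<le> sqrt ((norm (b - c))\<^sup>2 * real CARD('s))"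
    by (rule real_le_rsqrt)
  then have "(\<Sum>j\<in>UNIV. \<bar>(b - c) $ j\<bar>) \<le> sqrt (real CARD('s)) * norm (b - c)"
    by (simp add: real_sqrt_mult mult.commute)
  then have "lam * rho * (\<Sum>j\<in>UNIV. \<bar>(b - c) $ j\<bar>) \<le> lam * rho * (sqrt (real CARD('s)) * norm (b - c))"
    using lr by (intro mult_left_mono) auto
  moreover have "(\<Sum>j\<in>UNIV. p \<bar>c $ j\<bar> - p \<bar>b $ j\<bar>) \<le> (\<Sum>j\<in>UNIV. lam * rho * \<bar>(b - c) $ j\<bar>)"
    by (intro sum_mono each)
  ultimately show ?thesis
    by (simp add: sum_subtractf sum_distrib_left)
qed

section \<open>From the basic inequality to the error bound\<close>

lemma quadratic_form_diff:
  fixes A :: "real ^ 's ^ 's"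
  assumes "transpose A = A"
  shows "b \<bullet> (A *v b) - c \<bullet> (A *v c) = (b - c) \<bullet> (A *v (b + c))"
proof -
  have "c \<bullet> (A *v b) = b \<bullet> (A *v c)"
    by (metis assms dot_lmul_matrix inner_commute transpose_matrix_vector)
  then show ?thesis
    by (simp add: matrix_vector_right_distrib inner_diff_left inner_add_right)
qed

text \<open>Comparing the objective at \<open>b\<close> and at the truth \<open>c\<close> bounds the squared bilinear forms in
  \<open>u = b - c\<close>, \<open>v = b + c\<close> by the noise and the penalty. Of the two factors, \<open>v\<close> is the longer one,
  hence of norm at least \<open>norm c\<close>; dividing by \<open>norm u * (norm v)\<^sup>2\<close> leaves a bound on \<open>norm u\<close>.\<close>

lemma error_bound_closer_sign:
  fixes A :: "nat \<Rightarrow> real ^ 's ^ 's" and b c :: "real ^ 's"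
  assumes "n \<ge> 1" and sym: "\<And>i. i \<in> {1..n} \<Longrightarrow> transpose (A i) = A i"
    and y: "\<And>i. i \<in> {1..n} \<Longrightarrow> y i = c \<bullet> (A i *v c) + \<epsilon> i"
    and A1: "weakly_convex_concave_penalty lam rho p" and "lam > 0"
    and obj: "oracle_objective n A y p b \<le> oracle_objective n A y p c"
    and noise: "\<And>u v. (\<Sum>i=1..n. \<epsilon> i * (u \<bullet> (A i *v v))) \<le> H * norm u * norm v"
    and lower: "\<And>u v. c3 * (norm u)\<^sup>2 * (norm v)\<^sup>2 \<le> 1 / real n * (\<Sum>i=1..n. (u \<bullet> (A i *v v))\<^sup>2)"
    and "c3 > 0" "H \<ge> 0" and m: "0 < m" "m \<le> norm c"
    and closer: "norm (b - c) \<le> norm (b + c)"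
  shows "norm (b - c) \<le> 2 * H / (real n * c3 * m) + 4 * (lam * rho) * sqrt (real CARD('s)) / (c3 * m\<^sup>2)"
proof -
  define u v where "u = b - c" and "v = b + c"
  define \<Lambda> where "\<Lambda> = lam * rho * sqrt (real CARD('s))"
  have n: "real n > 0"
    using \<open>n \<ge> 1\<close> by simp
  have \<Lambda>: "\<Lambda> \<ge> 0"
    using A1 \<open>lam > 0\<close> by (simp add: \<Lambda>_def weakly_convex_concave_penalty_def)
  have "2 * norm c = norm (v - u)"
    unfolding u_def v_def by (simp add: scaleR_2[symmetric])
  also have "\<dots> \<le> norm v + norm u"
    by (rule norm_triangle_ineq4)
  finally have v: "m \<le> norm v"
    using closer m by (simp add: u_def v_def)
  then have v_pos: "norm v > 0"
    using m by linarith
  let ?q = "\<lambda>i. u \<bullet> (A i *v v)"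
  have res: "b \<bullet> (A i *v b) - y i = ?q i - \<epsilon> i" if "i \<in> {1..n}" for i
    using quadratic_form_diff[OF sym[OF that], of b c] y[OF that] by (simp add: u_def v_def)
  have "(\<Sum>i=1..n. (b \<bullet> (A i *v b) - y i)\<^sup>2) = (\<Sum>i=1..n. (?q i)\<^sup>2 - 2 * (\<epsilon> i * ?q i) + (\<epsilon> i)\<^sup>2)"
    by (intro sum.cong refl) (simp add: res power2_eq_square algebra_simps)
  also have "\<dots> = (\<Sum>i=1..n. (?q i)\<^sup>2) - 2 * (\<Sum>i=1..n. \<epsilon> i * ?q i) + (\<Sum>i=1..n. (\<epsilon> i)\<^sup>2)"
    by (simp add: sum.distrib sum_subtractf sum_distrib_left)
  finally have sq_b: "(\<Sum>i=1..n. (b \<bullet> (A i *v b) - y i)\<^sup>2) = \<dots>" .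
  have sq_c: "(\<Sum>i=1..n. (c \<bullet> (A i *v c) - y i)\<^sup>2) = (\<Sum>i=1..n. (\<epsilon> i)\<^sup>2)"
    by (intro sum.cong refl) (simp add: y)
  have "1 / (4 * real n) * ((\<Sum>i=1..n. (?q i)\<^sup>2) - 2 * (\<Sum>i=1..n. \<epsilon> i * ?q i))
      \<le> (\<Sum>j\<in>UNIV. p \<bar>c $ j\<bar>) - (\<Sum>j\<in>UNIV. p \<bar>b $ j\<bar>)"
    using obj unfolding oracle_objective_def sq_b sq_c by (simp add: algebra_simps)
  also have "\<dots> \<le> \<Lambda> * norm u"
    using sum_penalty_diff_le[OF A1 \<open>lam > 0\<close>, of c b] by (simp add: \<Lambda>_def u_def mult.assoc)
  finally have "(\<Sum>i=1..n. (?q i)\<^sup>2) \<le> 2 * (\<Sum>i=1..n. \<epsilon> i * ?q i) + 4 * real n * (\<Lambda> * norm u)"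
    using n by (simp add: field_simps)
  also have "\<dots> \<le> 2 * (H * norm u * norm v) + 4 * real n * (\<Lambda> * norm u)"
    using noise[of u v] by simp
  finally have "real n * (c3 * (norm u)\<^sup>2 * (norm v)\<^sup>2)
      \<le> 2 * (H * norm u * norm v) + 4 * real n * (\<Lambda> * norm u)"
    using lower[of u v] n by (simp add: field_simps)
  then have "norm u * (norm u * (real n * c3 * (norm v)\<^sup>2)) \<le> norm u * (2 * H * norm v + 4 * real n * \<Lambda>)"
    by (simp add: power2_eq_square algebra_simps)
  then have "norm u * (real n * c3 * (norm v)\<^sup>2) \<le> 2 * H * norm v + 4 * real n * \<Lambda>"
    using \<open>H \<ge> 0\<close> \<Lambda> n by (cases "norm u = 0") (auto simp: mult_le_cancel_left)
  then have "norm u \<le> (2 * H * norm v + 4 * real n * \<Lambda>) / (real n * c3 * (norm v)\<^sup>2)"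
    using n v_pos \<open>c3 > 0\<close> by (subst pos_le_divide_eq) auto
  also have "\<dots> = 2 * H / (real n * c3 * norm v) + 4 * \<Lambda> / (c3 * (norm v)\<^sup>2)"
    using n v_pos \<open>c3 > 0\<close> by (simp add: field_simps power2_eq_square)
  also have "\<dots> \<le> 2 * H / (real n * c3 * m) + 4 * \<Lambda> / (c3 * m\<^sup>2)"
    using n v v_pos m \<open>c3 > 0\<close> \<open>H \<ge> 0\<close> \<Lambda>
    by (intro add_mono divide_left_mono mult_left_mono power_mono mult_pos_pos) auto
  finally show ?thesis
    by (simp add: u_def \<Lambda>_def mult.assoc)
qed

text \<open>The objective is even, so the bound applies to whichever of \<open>b\<close> and \<open>- b\<close> is closer.\<close>

lemma error_bound_up_to_sign:
  fixes A :: "nat \<Rightarrow> real ^ 's ^ 's" and b c :: "real ^ 's"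
  assumes "n \<ge> 1" and sym: "\<And>i. i \<in> {1..n} \<Longrightarrow> transpose (A i) = A i"
    and y: "\<And>i. i \<in> {1..n} \<Longrightarrow> y i = c \<bullet> (A i *v c) + \<epsilon> i"
    and A1: "weakly_convex_concave_penalty lam rho p" and "lam > 0"
    and obj: "oracle_objective n A y p b \<le> oracle_objective n A y p c"
    and noise: "\<And>u v. (\<Sum>i=1..n. \<epsilon> i * (u \<bullet> (A i *v v))) \<le> H * norm u * norm v"
    and lower: "\<And>u v. c3 * (norm u)\<^sup>2 * (norm v)\<^sup>2 \<le> 1 / real n * (\<Sum>i=1..n. (u \<bullet> (A i *v v))\<^sup>2)"
    and "c3 > 0" "H \<ge> 0" and m: "0 < m" "m \<le> norm c"
  shows "norm_up_to_sign b c
    \<le> 2 * H / (real n * c3 * m) + 4 * (lam * rho) * sqrt (real CARD('s)) / (c3 * m\<^sup>2)"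
proof (cases "norm (b - c) \<le> norm (b + c)")
  case True
  have "norm (b - c) \<le> 2 * H / (real n * c3 * m) + 4 * (lam * rho) * sqrt (real CARD('s)) / (c3 * m\<^sup>2)"
    by (rule error_bound_closer_sign) (fact assms True)+
  then show ?thesis
    by (simp add: norm_up_to_sign_def)
next
  case False
  have "A i *v (- b) = - (A i *v b)" for i
    using matrix_vector_mult_scaleR[of "A i" "-1" b] by simp
  then have "oracle_objective n A y p (- b) = oracle_objective n A y p b"
    by (simp add: oracle_objective_def)
  then have obj': "oracle_objective n A y p (- b) \<le> oracle_objective n A y p c"
    using obj by simp
  have "norm (- b - c) = norm (b + c)" "norm (- b + c) = norm (b - c)"
    using norm_minus_cancel[of "b + c"] norm_minus_commute[of c b] by simp_all
  then have closer: "norm (- b - c) \<le> norm (- b + c)"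
    using False by linarith
  have "norm (- b - c) \<le> 2 * H / (real n * c3 * m) + 4 * (lam * rho) * sqrt (real CARD('s)) / (c3 * m\<^sup>2)"
    by (rule error_bound_closer_sign) (fact assms obj' closer)+
  then show ?thesis
    by (simp add: norm_up_to_sign_def)
qed

section \<open>The oracle estimator\<close>

lemma quadratic_form_submat:
  fixes b :: "real ^ 'd" and e :: "'s::finite \<Rightarrow> 'd::finite"
  assumes "bij_betw e UNIV (supp b)"
  shows "subvec e b \<bullet> (submat e A *v subvec e b) = b \<bullet> (A *v b)"
proof -
  have reindex: "(\<Sum>a\<in>UNIV. f (e a)) = (\<Sum>j\<in>UNIV. f j)" if "\<And>j. b $ j = 0 \<Longrightarrow> f j = 0"
    for f :: "'d \<Rightarrow> real"
  proof -
    have "(\<Sum>a\<in>UNIV. f (e a)) = (\<Sum>j\<in>supp b. f j)"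
      by (rule sum.reindex_bij_betw[OF assms])
    also have "\<dots> = (\<Sum>j\<in>UNIV. f j)"
      using that by (intro sum.mono_neutral_left) (auto simp: supp_def)
    finally show ?thesis .
  qed
  have "subvec e b \<bullet> (submat e A *v subvec e b)
      = (\<Sum>a\<in>UNIV. b $ e a * (\<Sum>a'\<in>UNIV. A $ e a $ e a' * b $ e a'))"
    by (simp add: inner_vec_def matrix_vector_mult_def subvec_def submat_def)
  also have "\<dots> = (\<Sum>a\<in>UNIV. b $ e a * (\<Sum>k\<in>UNIV. A $ e a $ k * b $ k))"
    by (subst reindex[where f = "\<lambda>k. A $ e _ $ k * b $ k"]) auto
  also have "\<dots> = (\<Sum>j\<in>UNIV. b $ j * (\<Sum>k\<in>UNIV. A $ j $ k * b $ k))"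
    by (rule reindex) simp
  also have "\<dots> = b \<bullet> (A *v b)"
    by (simp add: inner_vec_def matrix_vector_mult_def)
  finally show ?thesis .
qed

lemma norm_subvec_supp_ge:
  fixes b :: "real ^ 'd" and e :: "'s::finite \<Rightarrow> 'd::finite"
  assumes "bij_betw e UNIV (supp b)" and c: "0 \<le> c" "\<And>j. j \<in> supp b \<Longrightarrow> c \<le> \<bar>b $ j\<bar>"
  shows "c * sqrt (real CARD('s)) \<le> norm (subvec e b)"
proof -
  have "real CARD('s) * c\<^sup>2 = (\<Sum>a\<in>(UNIV :: 's set). c\<^sup>2)"
    by simp
  also have "\<dots> \<le> (\<Sum>a\<in>UNIV. \<bar>b $ e a\<bar>\<^sup>2)"
    using assms by (intro sum_mono power_mono) (auto simp: bij_betw_def)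
  finally have "sqrt (real CARD('s) * c\<^sup>2) \<le> norm (subvec e b)"
    by (simp add: norm_vec_def L2_set_def subvec_def)
  then show ?thesis
    using c by (simp add: real_sqrt_mult mult.commute)
qed

theorem theorem1:
  fixes M :: "'w measure"
    and n s :: nat and d :: "nat \<Rightarrow> nat"
    and Z :: "nat \<Rightarrow> real ^ 'd ^ 'd" and \<beta> :: "real ^ 'd"
    and e :: "'s::finite \<Rightarrow> 'd::finite"
    and \<epsilon> y :: "nat \<Rightarrow> 'w \<Rightarrow> real"
    and p :: "real \<Rightarrow> real"
    and \<beta>hat :: "'w \<Rightarrow> real ^ 's"
    and \<alpha> c1 c2 c3 c4 \<sigma> lam rho :: real
  assumes "prob_space M"
    and "n \<ge> 1"
    and "s = card (supp \<beta>)"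
    and "bij_betw e UNIV (supp \<beta>)"
    and "\<And>i. i \<in> {1..n} \<Longrightarrow> transpose (Z i) = Z i"
    and model: "\<And>i \<omega>. i \<in> {1..n} \<Longrightarrow> \<omega> \<in> space M \<Longrightarrow> y i \<omega> = \<beta> \<bullet> (Z i *v \<beta>) + \<epsilon> i \<omega>"
    and "lam > 0" and "\<sigma> > 0"
    and high_dim: "d n = CARD('d)" "d n > n" "0 < \<alpha>" "\<alpha> < 1"
      "(\<lambda>m. ln (real (d m))) \<in> o(\<lambda>m. real m powr \<alpha>)"
    and signal: "0 < c1" "c1 \<le> c2" "\<And>j. j \<in> supp \<beta> \<Longrightarrow> c1 \<le> \<bar>\<beta> $ j\<bar> \<and> \<bar>\<beta> $ j\<bar> \<le> c2"
    and std: "prob_space.standardized M n Z y"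
    and A1: "weakly_convex_concave_penalty lam rho p"
    and A2: "prob_space.iid_subgaussian_errors M \<sigma> n \<epsilon>"
    and A3: "0 < c3" "c3 \<le> c4"
      "\<And>u v :: real ^ 's.
         c3 * (norm u)\<^sup>2 * (norm v)\<^sup>2
           \<le> 1 / real n * (\<Sum>i=1..n. (u \<bullet> (submat e (Z i) *v v))\<^sup>2) \<and>
         1 / real n * (\<Sum>i=1..n. (u \<bullet> (submat e (Z i) *v v))\<^sup>2)
           \<le> c4 * (norm u)\<^sup>2 * (norm v)\<^sup>2"
    and estimator: "\<beta>hat \<in> borel_measurable M"
      "\<And>\<omega>. \<omega> \<in> space M \<Longrightarrow>
         is_arg_min (oracle_objective n (\<lambda>i. submat e (Z i)) (\<lambda>i. y i \<omega>) p)
           (\<lambda>_. True) (\<beta>hat \<omega>)"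
    and "c4 \<ge> 3 / (real n * real s)"
  shows "let p1 = 2 * exp (- real s * ln (1 + 2 * real n));
             p2 = real n powr (- real n / 2);
             C0 = max (10 * \<sigma> * sqrt c4 / (c1 * c3)) (4 / (c1\<^sup>2 * c3));
             r = C0 * (sqrt (ln (1 + 2 * real n) / real n) + lam * rho / sqrt (real s))
         in prob_space.prob M {\<omega> \<in> space M. norm_up_to_sign (\<beta>hat \<omega>) (subvec e \<beta>) \<le> r}
              \<ge> 1 - p1 - p2"
proof -
  interpret prob_space M by fact
  have s: "s = CARD('s)"
    using bij_betw_same_card[OF assms(4)] assms(3) by simp
  then have s_pos: "real s > 0"
    by simp
  have n: "real n \<ge> 1"
    using \<open>n \<ge> 1\<close> by simp
  have c4: "c4 > 0"
    using A3 by simp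
  define L where "L = ln (1 + 2 * real n)"
  have L: "L > 0"
    using n by (simp add: L_def)
  have eL: "exp L = 1 + 2 * real n"
    using n by (simp add: L_def)
  define K where "K = real n * c4"
  have K: "K > 0"
    using n c4 by (simp add: K_def)
  \<comment> \<open>With this \<open>t\<close>, the Chernoff exponent is \<open>8 s L\<close>, while the net contributes \<open>6 s L\<close>.\<close>
  define t where "t = 4 * \<sigma> * sqrt (K * real s * L)"
  have t: "t > 0"
    using \<open>\<sigma> > 0\<close> K L s_pos by (simp add: t_def)
  let ?A = "\<lambda>i. submat e (Z i)" and ?b = "subvec e \<beta>"
  have upper: "(\<Sum>i=1..n. (u \<bullet> (?A i *v v))\<^sup>2) \<le> K * (norm u)\<^sup>2 * (norm v)\<^sup>2" for u v :: "real ^ 's"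
    using A3(3)[of u v] n by (simp add: K_def field_simps)
  obtain G where G: "G \<in> events"
    "prob G \<ge> 1 - 21 ^ (2 * CARD('s)) * exp (- (t\<^sup>2 / (2 * \<sigma>\<^sup>2 * K)))"
    "\<And>\<omega> x y. \<omega> \<in> G \<Longrightarrow> (\<Sum>i=1..n. \<epsilon> i \<omega> * (x \<bullet> (?A i *v y))) \<le> 5 / 4 * t * norm x * norm y"
    by (rule subgaussian_bilinear_form_bound[of "{1..n}" \<epsilon> \<sigma> K t ?A])
      (use A2 upper \<open>\<sigma> > 0\<close> K t in \<open>auto simp: iid_subgaussian_errors_def\<close>)
  have exponent: "t\<^sup>2 / (2 * \<sigma>\<^sup>2 * K) = 8 * (real s * L)"
    using \<open>\<sigma> > 0\<close> K L s_pos by (simp add: t_def power_mult_distrib field_simps)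
  \<comment> \<open>The size of the net is absorbed into powers of \<open>exp L = 1 + 2 n \<ge> 3\<close>.\<close>
  have "(21::real) \<le> 3 ^ 3"
    by simp
  also have "\<dots> \<le> exp L ^ 3"
    using n by (intro power_mono) (auto simp: eL)
  finally have "(21::real) ^ (2 * s) \<le> (exp L ^ 3) ^ (2 * s)"
    by (intro power_mono) auto
  also have "\<dots> = exp (6 * (real s * L))"
    by (simp add: power_mult[symmetric] exp_of_nat_mult[symmetric] algebra_simps)
  finally have "21 ^ (2 * s) * exp (- (8 * (real s * L))) \<le> exp (6 * (real s * L)) * exp (- (8 * (real s * L)))"
    by (intro mult_right_mono) auto
  also have "\<dots> = exp (- 2 * (real s * L))"
    by (simp add: exp_add[symmetric])
  also have "\<dots> \<le> 2 * exp (- real s * L)"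
  proof -
    have "0 \<le> real s * L"
      using s_pos L by simp
    then have "exp (- 2 * (real s * L)) \<le> exp (- real s * L)"
      by (simp add: mult.commute)
    then show ?thesis
      using exp_ge_zero[of "- real s * L"] by linarith
  qed
  finally have tail: "21 ^ (2 * s) * exp (- (8 * (real s * L))) \<le> 2 * exp (- real s * L)" .
  have prob_G: "prob G \<ge> 1 - 2 * exp (- real s * L) - real n powr (- real n / 2)"
    using G(2) powr_ge_zero[of "real n" "- real n / 2"] tail
    unfolding exponent s by linarith

  define \<Lambda> where "\<Lambda> = lam * rho"
  have \<Lambda>: "\<Lambda> > 0"
    using A1 \<open>lam > 0\<close> by (simp add: \<Lambda>_def weakly_convex_concave_penalty_def)
  define C0 where "C0 = max (10 * \<sigma> * sqrt c4 / (c1 * c3)) (4 / (c1\<^sup>2 * c3))"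
  define r where "r = C0 * (sqrt (L / real n) + \<Lambda> / sqrt (real s))"
  have error: "norm_up_to_sign (\<beta>hat \<omega>) ?b \<le> r" if "\<omega> \<in> G" for \<omega>
  proof -
    have \<omega>: "\<omega> \<in> space M"
      using that G(1) sets.sets_into_space by blast
    have obj: "oracle_objective n ?A (\<lambda>i. y i \<omega>) p (\<beta>hat \<omega>) \<le> oracle_objective n ?A (\<lambda>i. y i \<omega>) p ?b"
      using estimator(2)[OF \<omega>] by (auto simp: is_arg_min_linorder)
    have sym: "transpose (?A i) = ?A i" if "i \<in> {1..n}" for i
      using assms(5)[OF that] by (simp add: submat_def transpose_def vec_eq_iff)
    have y: "y i \<omega> = ?b \<bullet> (?A i *v ?b) + \<epsilon> i \<omega>" if "i \<in> {1..n}" for i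
      using model[OF that \<omega>] quadratic_form_submat[OF assms(4)] by simp
    have "norm_up_to_sign (\<beta>hat \<omega>) ?b
        \<le> 2 * (5 / 4 * t) / (real n * c3 * (c1 * sqrt (real s)))
          + 4 * (lam * rho) * sqrt (real CARD('s)) / (c3 * (c1 * sqrt (real s))\<^sup>2)"
    proof (rule error_bound_up_to_sign[OF \<open>n \<ge> 1\<close> sym y A1 \<open>lam > 0\<close> obj G(3)[OF that]])
      show "c3 * (norm u)\<^sup>2 * (norm v)\<^sup>2 \<le> 1 / real n * (\<Sum>i=1..n. (u \<bullet> (?A i *v v))\<^sup>2)"
        for u v :: "real ^ 's"
        using A3(3) by blast
      show "c1 * sqrt (real s) \<le> norm ?b"
        unfolding s using signal by (intro norm_subvec_supp_ge assms(4)) auto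
    qed (use A3 t signal s_pos in auto)
    also have "2 * (5 / 4 * t) / (real n * c3 * (c1 * sqrt (real s)))
        = 10 * \<sigma> * sqrt c4 / (c1 * c3) * sqrt (L / real n)"
    proof -
      define a where "a = sqrt (real n)"
      have a: "real n = a * a" "a > 0"
        using n by (simp_all add: a_def)
      have "t = 4 * \<sigma> * (a * sqrt c4 * sqrt (real s) * sqrt L)"
        by (simp add: t_def K_def a_def real_sqrt_mult)
      then show ?thesis
        unfolding real_sqrt_divide a_def[symmetric] using a s_pos A3 signal
        by (simp add: field_simps)
    qed
    also have "4 * (lam * rho) * sqrt (real CARD('s)) / (c3 * (c1 * sqrt (real s))\<^sup>2)
        = 4 / (c1\<^sup>2 * c3) * (\<Lambda> / sqrt (real s))"
      using s_pos A3 signal unfolding s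
      by (simp add: \<Lambda>_def power_mult_distrib power2_eq_square field_simps)
    also have "10 * \<sigma> * sqrt c4 / (c1 * c3) * sqrt (L / real n) + 4 / (c1\<^sup>2 * c3) * (\<Lambda> / sqrt (real s)) \<le> r"
      unfolding r_def distrib_left using L \<Lambda> by (intro add_mono mult_right_mono) (auto simp: C0_def)
    finally show ?thesis .
  qed
  have "G \<subseteq> {\<omega> \<in> space M. norm_up_to_sign (\<beta>hat \<omega>) ?b \<le> r}"
    using error sets.sets_into_space[OF G(1)] by auto
  moreover have "{\<omega> \<in> space M. norm_up_to_sign (\<beta>hat \<omega>) ?b \<le> r} \<in> events"
    using estimator(1) unfolding norm_up_to_sign_def by measurable
  ultimately have "prob G \<le> prob {\<omega> \<in> space M. norm_up_to_sign (\<beta>hat \<omega>) ?b \<le> r}"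
    by (rule finite_measure_mono)
  then show ?thesis
    using prob_G unfolding Let_def r_def C0_def \<Lambda>_def L_def by linarith
qed

end
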